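(* Let $n$ be a positive integer. The poset $S\text{-}Block(n)$ is the disjoint union of the sets $A(n,k)$, for all integers $k\ge 1$ with $\binom{k+1}{2}\le n$, and $A(n,k,k-1)$, for all integers $k\ge 2$ with $\binom{k+1}{2}\le n$, and each of these sets is an amphora in $S\text{-}Block(n)$.
   Context: $Dis(n)$ is the set of partitions $\gamma=(g_1,\dots,g_r)$ of $n$ into distinct positive parts $g_1>\dots>g_r>0$, with $\mathrm{len}(\gamma)=r$; $Dis_k(n)$ is the subset of those with exactly $k$ parts. For $\gamma=(g_1,\dots,g_r)$ and $\delta=(d_1,\dots,d_s)$ in $Dis(n)$, $\delta\succeq\gamma$ ($\delta$ majorizes $\gamma$) means $\sum_{i=1}^m d_i\ge\sum_{i=1}^m g_i$ for all $m\le\min\{r,s\}$. An $S$-block is an ordered pair $[\alpha|\beta]$ with $\alpha,\beta\in Dis(n)$, $\beta\succeq\alpha$, and $\mathrm{len}(\alpha)\in\{\mathrm{len}(\beta),\mathrm{len}(\beta)+1\}$. $S\text{-}Block(n)$ is the poset of all such $S$-blocks, ordered by $[\alpha_1|\beta_1]\succeq[\alpha_2|\beta_2]$ iff $\alpha_1\succeq\alpha_2$ and $\beta_1\preceq\beta_2$. For $n\ge\binom{k+1}{2}$: $A(n,k)$ is the subposet of $S$-blocks $[\alpha|\beta]$ with $\alpha,\beta\in Dis_k(n)$; $A(n,k,k-1)$ is the subposet of $S$-blocks $[\alpha|\beta]$ with $\alpha\in Dis_k(n)$ and $\beta\in Dis_{k-1}(n)$. Given a poset $P$, a subposet $P'$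 is an amphora if there exist an antichain $A$ in $P$ and an element $x$ less than or equal to every element of $A$ such that $P'$ consists of all elements of $P$ that are greater than or equal to $x$ and less than or equal to some element of $A$. *)

theory Defs
  imports Main "HOL-Library.Disjoint_Sets"
begin

text \<open>A partition into distinct parts is the strictly decreasing list of its parts.\<close>

definition Dis :: "nat \<Rightarrow> nat list set" where
  "Dis n = {g. sorted_wrt (>) g \<and> (\<forall>p \<in> set g. p > 0) \<and> sum_list g = n}"

definition Dis_parts :: "nat \<Rightarrow> nat \<Rightarrow> nat list set" where
  "Dis_parts n k = {g \<in> Dis n. length g = k}"

definition majorizes :: "nat list \<Rightarrow> nat list \<Rightarrow> bool" where
  "majorizes d g \<longleftrightarrow>
     (\<forall>m \<le> min (length g) (length d). sum_list (take m d) \<ge> sum_list (take m g))"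

type_synonym block = "nat list \<times> nat list"

definition S_Block :: "nat \<Rightarrow> block set" where
  "S_Block n = {(\<alpha>, \<beta>). \<alpha> \<in> Dis n \<and> \<beta> \<in> Dis n \<and> majorizes \<beta> \<alpha> \<and>
     (length \<alpha> = length \<beta> \<or> length \<alpha> = length \<beta> + 1)}"

text \<open>The order of \<open>S_Block n\<close> as a set of pairs: \<open>(x, y)\<close> is in it iff \<open>x\<close> is
  less than or equal to \<open>y\<close>.\<close>

definition S_Block_le :: "nat \<Rightarrow> block rel" where
  "S_Block_le n = {((\<alpha>\<^sub>1, \<beta>\<^sub>1), (\<alpha>\<^sub>2, \<beta>\<^sub>2)).
     (\<alpha>\<^sub>1, \<beta>\<^sub>1) \<in> S_Block n \<and> (\<alpha>\<^sub>2, \<beta>\<^sub>2) \<in> S_Block n \<and>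
     majorizes \<alpha>\<^sub>2 \<alpha>\<^sub>1 \<and> majorizes \<beta>\<^sub>1 \<beta>\<^sub>2}"

definition A_same :: "nat \<Rightarrow> nat \<Rightarrow> block set" where
  "A_same n k = {(\<alpha>, \<beta>) \<in> S_Block n. \<alpha> \<in> Dis_parts n k \<and> \<beta> \<in> Dis_parts n k}"

text \<open>The set $A(n,k,k-1)$, used for \<open>k \<ge> 2\<close> only.\<close>

definition A_drop :: "nat \<Rightarrow> nat \<Rightarrow> block set" where
  "A_drop n k = {(\<alpha>, \<beta>) \<in> S_Block n. \<alpha> \<in> Dis_parts n k \<and> \<beta> \<in> Dis_parts n (k - 1)}"

text \<open>For a poset with carrier \<open>P\<close> and order relation \<open>r\<close>.\<close>

definition antichain_in :: "'a set \<Rightarrow> 'a rel \<Rightarrow> 'a set \<Rightarrow> bool" where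
  "antichain_in P r A \<longleftrightarrow> A \<subseteq> P \<and> (\<forall>a \<in> A. \<forall>b \<in> A. (a, b) \<in> r \<longrightarrow> a = b)"

definition amphora :: "'a set \<Rightarrow> 'a rel \<Rightarrow> 'a set \<Rightarrow> bool" where
  "amphora P r P' \<longleftrightarrow>
     (\<exists>A x. antichain_in P r A \<and> x \<in> P \<and> (\<forall>a \<in> A. (x, a) \<in> r) \<and>
        P' = {y \<in> P. (x, y) \<in> r \<and> (\<exists>a \<in> A. (y, a) \<in> r)})"

lemma majorizes_length:
  assumes d: "d \<in> Dis n" and g: "g \<in> Dis n" and m: "majorizes d g"
  shows "length d \<le> length g"
proof (rule ccontr)
  assume "\<not> ?thesis"
  then have l: "length g < length d" by simp
  have "sum_list (take (length g) d) \<ge> sum_list g"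
    using m l unfolding majorizes_def by (metis min.absorb3 order_refl take_all)
  moreover have "sum_list d = sum_list (take (length g) d) + sum_list (drop (length g) d)"
    by (metis append_take_drop_id sum_list_append)
  ultimately have z: "sum_list (drop (length g) d) = 0"
    using d g unfolding Dis_def by (simp del: sum_list_eq_0_iff)
  have "d ! length g \<in> set (drop (length g) d)"
    using l by (metis Cons_nth_drop_Suc list.set_intros(1))
  moreover have "d ! length g > 0" using d l unfolding Dis_def by simp
  ultimately show False using z by (metis less_numeral_extra(3) sum_list_eq_0_iff)
qed

lemma majorizes_trans:
  assumes "c \<in> Dis n" "d \<in> Dis n" "e \<in> Dis n" "majorizes c d" "majorizes d e"
  shows "majorizes c e"
  using assms(4,5) majorizes_length[OF assms(1,2,4)] majorizes_length[OF assms(2,3,5)]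
  unfolding majorizes_def by (auto intro: order_trans)

lemma majorizes_antisym:
  assumes d: "d \<in> Dis n" and g: "g \<in> Dis n" and m: "majorizes d g" "majorizes g d"
  shows "d = g"
proof (rule nth_equalityI)
  show l: "length d = length g"
    using majorizes_length[OF d g m(1)] majorizes_length[OF g d m(2)] by simp
  fix i assume i: "i < length d"
  have s: "sum_list (take j d) = sum_list (take j g)" if "j \<le> length d" for j
    using m that l unfolding majorizes_def by (intro antisym) auto
  show "d ! i = g ! i"
    using s[of i] s[of "Suc i"] i l by (simp add: take_Suc_conv_app_nth)
qed

lemma partial_order_S_Block: "partial_order_on (S_Block n) (S_Block_le n)"
proof -
  have r: "refl_on (S_Block n) (S_Block_le n)"
    unfolding refl_on_def S_Block_le_def by (auto simp: majorizes_def)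
  have s: "S_Block_le n \<subseteq> S_Block n \<times> S_Block n"
    unfolding S_Block_le_def by auto
  have t: "trans (S_Block_le n)"
    unfolding trans_def S_Block_le_def S_Block_def
    by (auto intro: majorizes_trans)
  have a: "antisym (S_Block_le n)"
    unfolding antisym_def S_Block_le_def S_Block_def
    by (auto intro: majorizes_antisym)
  show ?thesis
    unfolding partial_order_on_def preorder_on_def using r s t a by auto
qed

end

theory Submission
  imports Defs
begin

text \<open>
  If \<open>\<beta>\<close> majorizes \<open>\<alpha>\<close> then \<open>\<beta>\<close> has at most as many parts as \<open>\<alpha>\<close>. Going up in the order of
  \<open>S\<close>-blocks therefore can only shorten \<open>\<alpha>\<close> and lengthen \<open>\<beta>\<close>, so the blocks with prescribed
  lengths \<open>k\<close> and \<open>l\<close> of the two components form a convex subset. These subsets, for \<open>l = k\<close>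
  and \<open>l = k - 1\<close>, are the sets \<open>A(n,k)\<close> and \<open>A(n,k,k-1)\<close>; they partition the poset because the
  lengths determine the subset.

  In a finite poset, a convex subset with a least element is an amphora: its maximal elements form
  the antichain (lemma \<open>convex_with_least_imp_amphora\<close>). So all that is left is to find a least
  block with lengths \<open>k\<close> and \<open>l\<close>. It consists of the least element, in the majorization order,
  among the partitions with \<open>k\<close> parts, and the greatest among those with \<open>l\<close> parts.
  \<^item> The greatest one is \<open>(n - (l choose 2), l - 1, \<dots>, 2, 1)\<close>: its tails have the smallest sums that
    distinct positive parts allow, hence its initial sums are largest. It even majorizes every
    partition with at least \<open>l\<close> parts, so the two components do form an \<open>S\<close>-block when
    \<open>l = k - 1\<close>.
  \<^item> The least one has parts as close together as possible: they are consecutive integers except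
    for at most one gap of \<open>2\<close>. Once a partition \<open>\<alpha>\<close> with \<open>k\<close> parts drops below this one, it stays
    weakly below, since it falls by at least \<open>1\<close> at each step. The difference thus changes sign at
    most once, from plus to minus, and has sum \<open>0\<close>; hence its initial sums are nonnegative.
\<close>

section \<open>Convex subsets of finite posets\<close>

text \<open>By finiteness every element of \<open>Q\<close> lies below a maximal element of \<open>Q\<close>; the maximal elements
  are the antichain that closes the amphora from above.\<close>

lemma convex_with_least_imp_amphora:
  assumes po: "partial_order_on P r" and sub: "Q \<subseteq> P" and fin: "finite Q"
    and x: "x \<in> Q" and least: "\<And>y. y \<in> Q \<Longrightarrow> (x, y) \<in> r"
    and convex: "\<And>y a. y \<in> P \<Longrightarrow> a \<in> Q \<Longrightarrow> (x, y) \<in> r \<Longrightarrow> (y, a) \<in> r \<Longrightarrow> y \<in> Q"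
  shows "amphora P r Q"
proof -
  define A where "A = {a \<in> Q. \<forall>b\<in>Q. (a, b) \<in> r \<longrightarrow> a = b}"
  have trans: "trans r" and antisym: "antisym r" and refl: "refl_on P r"
    using po unfolding partial_order_on_def preorder_on_def by auto
  have above: "\<exists>a\<in>A. (y, a) \<in> r" if y: "y \<in> Q" for y
  proof -
    let ?U = "{z \<in> Q. (y, z) \<in> r}"
    let ?R = "\<lambda>a b. (a, b) \<in> r \<and> a \<noteq> b"
    have "finite ?U" using fin by simp
    moreover have "asymp_on ?U ?R"
      using antisym by (intro asymp_onI) (auto dest: antisymD)
    moreover have "transp_on ?U ?R"
      using trans antisym by (intro transp_onI) (metis antisymD transD)
    moreover have "?U \<noteq> {}"
      using y sub refl unfolding refl_on_def by blast
    ultimately have "\<exists>m\<in>?U. \<forall>z\<in>?U. z \<noteq> m \<longrightarrow> \<not> ?R m z"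
      by (rule Finite_Set.bex_max_element)
    then obtain m where m: "m \<in> ?U" "\<And>z. z \<in> ?U \<Longrightarrow> (m, z) \<in> r \<Longrightarrow> m = z"
      by auto
    have "m = b" if "b \<in> Q" "(m, b) \<in> r" for b
      using m that transD[OF trans, of y m b] by auto
    then show ?thesis using m unfolding A_def by blast
  qed
  have "antichain_in P r A"
    using sub unfolding antichain_in_def A_def by blast
  moreover have "\<forall>a\<in>A. (x, a) \<in> r"
    using least unfolding A_def by blast
  moreover have "Q = {y \<in> P. (x, y) \<in> r \<and> (\<exists>a\<in>A. (y, a) \<in> r)}"
    using sub least above convex unfolding A_def by blast
  ultimately show ?thesis
    using x sub unfolding amphora_def by blast
qed

section \<open>Partitions into distinct parts\<close>

lemma choose_two_Suc: "Suc k choose 2 = (k choose 2) + k"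
  by (simp add: numeral_2_eq_2)

lemma finite_Dis: "finite (Dis n)"
proof (rule finite_subset)
  show "Dis n \<subseteq> {g. set g \<subseteq> {..n} \<and> distinct g}"
  proof
    fix g assume "g \<in> Dis n"
    then have g: "sorted_wrt (>) g" "sum_list g = n" by (auto simp: Dis_def)
    have "distinct g" using g(1) by (induction g) auto
    then show "g \<in> {g. set g \<subseteq> {..n} \<and> distinct g}"
      using g(2) member_le_sum_list[of _ g] by auto
  qed
  show "finite {g. set g \<subseteq> {..n} \<and> distinct g}"
    by (intro finite_subset_distinct) simp
qed

lemma finite_S_Block: "finite (S_Block n)"
  by (rule finite_subset[of _ "Dis n \<times> Dis n"]) (auto simp: S_Block_def finite_Dis)

lemma strictly_decreasing_nth_gap:
  fixes g :: "nat list"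
  assumes g: "sorted_wrt (>) g" and ij: "i \<le> j" and j: "j < length g"
  shows "g ! j + (j - i) \<le> g ! i"
  using ij j
proof (induction j rule: dec_induct)
  case (step j)
  have "g ! Suc j < g ! j"
    using g step.prems by (simp add: sorted_wrt_iff_nth_less)
  then show ?case using step by simp
qed simp

lemma choose_two_le_sum_list:
  assumes "sorted_wrt (>) g" "\<forall>p\<in>set g. p > (0::nat)"
  shows "(length g + 1) choose 2 \<le> sum_list g"
  using assms
proof (induction g)
  case (Cons x g)
  have "length g + 1 \<le> x"
  proof -
    have "(x # g) ! length g + (length g - 0) \<le> (x # g) ! 0"
      using Cons.prems by (intro strictly_decreasing_nth_gap) auto
    moreover have "(x # g) ! length g > 0"
      using Cons.prems(2) by (metis length_Cons lessI nth_mem)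
    ultimately show ?thesis by simp
  qed
  then show ?case using Cons choose_two_Suc[of "Suc (length g)"] by simp
qed simp

lemma choose_two_le_sum_list_drop:
  assumes "g \<in> Dis n"
  shows "(length g - m + 1) choose 2 \<le> sum_list (drop m g)"
proof -
  have "sorted_wrt (>) (drop m g)" "\<forall>p\<in>set (drop m g). p > 0"
    using assms by (auto simp: Dis_def sorted_wrt_drop dest: in_set_dropD)
  from choose_two_le_sum_list[OF this] show ?thesis by simp
qed

lemma sum_list_take_drop: "g \<in> Dis n \<Longrightarrow> sum_list (take m g) + sum_list (drop m g) = n"
  by (simp add: Dis_def flip: sum_list_append)

section \<open>The greatest partition with a given number of parts\<close>

definition top_partition :: "nat \<Rightarrow> nat \<Rightarrow> nat list" where
  "top_partition n l = (n - (l choose 2)) # rev [1..<l]"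

lemma sum_list_rev_upt: "sum_list (rev [1..<Suc l]) = Suc l choose 2"
  by (induction l) (auto simp: choose_two_Suc)

lemma top_partition_in_Dis:
  assumes "l \<ge> 1" "(l + 1) choose 2 \<le> n"
  shows "top_partition n l \<in> Dis_parts n l"
proof -
  obtain l' where l': "l = Suc l'" using assms(1) by (cases l) auto
  have head: "l + (l choose 2) \<le> n"
    using assms choose_two_Suc[of l] by simp
  have "sorted_wrt (>) (rev [1..<l])"
    by (simp add: sorted_wrt_rev)
  moreover have "sum_list (rev [1..<l]) = l choose 2"
    unfolding l' by (rule sum_list_rev_upt)
  ultimately show ?thesis
    using head assms(1) by (auto simp: Dis_parts_def Dis_def top_partition_def)
qed

lemma sum_list_drop_top_partition:
  assumes "1 \<le> m" "m \<le> l"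
  shows "sum_list (drop m (top_partition n l)) = (l - m + 1) choose 2"
proof -
  obtain m' where m': "m = Suc m'" using assms(1) by (cases m) auto
  have "drop m (top_partition n l) = rev [1..<Suc (l - m)]"
    using assms unfolding m' top_partition_def
    by (simp add: drop_rev take_upt Suc_diff_le del: upt_Suc)
  then show ?thesis using sum_list_rev_upt[of "l - m"] by simp
qed

text \<open>Initial sums are largest when the complementary tails have the least sum possible, which is
  that of a staircase. A longer \<open>g\<close> has longer tails, so the bound covers it as well.\<close>

lemma top_partition_majorizes:
  assumes l: "l \<ge> 1" "(l + 1) choose 2 \<le> n" and g: "g \<in> Dis n" "l \<le> length g"
  shows "majorizes (top_partition n l) g"
  unfolding majorizes_def
proof (intro allI impI)
  fix m assume "m \<le> min (length g) (length (top_partition n l))"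
  then have m: "m \<le> l"
    using top_partition_in_Dis[OF l] by (simp add: Dis_parts_def)
  show "sum_list (take m g) \<le> sum_list (take m (top_partition n l))"
  proof (cases "m = 0")
    case False
    have "sum_list (drop m (top_partition n l)) = (l - m + 1) choose 2"
      using False m by (intro sum_list_drop_top_partition) auto
    also have "\<dots> \<le> (length g - m + 1) choose 2"
      using g(2) by (intro binomial_right_mono) auto
    also have "\<dots> \<le> sum_list (drop m g)"
      by (rule choose_two_le_sum_list_drop[OF g(1)])
    finally show ?thesis
      using sum_list_take_drop[OF g(1), of m]
        sum_list_take_drop[of "top_partition n l" n m] top_partition_in_Dis[OF l]
      by (simp add: Dis_parts_def)
  qed simp
qed

section \<open>The least partition with a given number of parts\<close>

text \<open>The surplus over the staircase \<open>(k - 1, \<dots>, 1, 0)\<close> is spread evenly over the parts, with the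
  remainder going to the first ones.\<close>

definition bottom_partition :: "nat \<Rightarrow> nat \<Rightarrow> nat list" where
  "bottom_partition n k =
     (let N = n - (k choose 2)
      in map (\<lambda>i. (k - 1 - i) + N div k + (if i < N mod k then 1 else 0)) [0..<k])"

lemma sum_staircase: "(\<Sum>i<k. k - 1 - i) = k choose 2"
proof (induction k)
  case (Suc k)
  have "(\<Sum>i<Suc k. Suc k - 1 - i) = k + (\<Sum>i<k. k - 1 - i)"
    by (subst sum.lessThan_Suc_shift) simp
  then show ?case using Suc choose_two_Suc[of k] by simp
qed simp

lemma bottom_partition_in_Dis:
  assumes "k \<ge> 1" "(k + 1) choose 2 \<le> n"
  shows "bottom_partition n k \<in> Dis_parts n k"
proof -
  define N where "N = n - (k choose 2)"
  define f where "f = (\<lambda>i. (k - 1 - i) + N div k + (if i < N mod k then 1 else 0))"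
  have bp: "bottom_partition n k = map f [0..<k]"
    unfolding bottom_partition_def f_def N_def Let_def by simp
  have kN: "k \<le> N" and n: "n = (k choose 2) + N"
    using assms choose_two_Suc[of k] unfolding N_def by auto
  have "N div k \<ge> 1"
    using kN assms(1) by (simp add: div_greater_zero_iff Suc_le_eq)
  then have pos: "f i > 0" for i unfolding f_def by simp
  have dec: "f j < f i" if "i < j" "j < k" for i j
    using that unfolding f_def by auto
  have r: "N mod k < k" using assms(1) by simp
  have "(\<Sum>i<k. if i < N mod k then 1 else 0 :: nat) = N mod k"
  proof -
    have "(\<Sum>i<k. if i < N mod k then 1 else 0 :: nat) = card {i. i < k \<and> i < N mod k}"
      by (simp add: sum.If_cases Int_def)
    also have "{i. i < k \<and> i < N mod k} = {..<N mod k}" using r by auto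
    finally show ?thesis by simp
  qed
  then have "(\<Sum>i<k. f i) = (k choose 2) + k * (N div k) + N mod k"
    unfolding f_def sum.distrib sum_staircase by simp
  then have "sum_list (map f [0..<k]) = n"
    using n by (simp add: sum_list_distinct_conv_sum_set atLeast0LessThan algebra_simps)
  then show ?thesis
    unfolding bp Dis_parts_def Dis_def
    using pos dec by (auto simp: sorted_wrt_iff_nth_less)
qed

lemma bottom_partition_gap:
  assumes "i \<le> j" "j < k"
  shows "bottom_partition n k ! i \<le> bottom_partition n k ! j + (j - i) + 1"
  using assms unfolding bottom_partition_def Let_def by auto

text \<open>The difference of \<open>g\<close> and \<open>b\<close> changes sign at most once, from plus to minus: after a position
  \<open>i\<close> where \<open>g\<close> is smaller, \<open>g\<close> falls by at least \<open>j - i\<close> up to position \<open>j\<close>, and \<open>b\<close> by at most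
  one more than that. So either the first \<open>m\<close> differences are all nonnegative or the remaining ones
  are all nonpositive.\<close>

lemma majorizes_of_small_gaps:
  assumes g: "g \<in> Dis_parts n k" and b: "b \<in> Dis_parts n k"
    and gap: "\<And>i j. i \<le> j \<Longrightarrow> j < k \<Longrightarrow> b ! i \<le> b ! j + (j - i) + 1"
  shows "majorizes g b"
  unfolding majorizes_def
proof (intro allI impI)
  fix m assume "m \<le> min (length b) (length g)"
  have len: "length g = k" "length b = k" and gn: "g \<in> Dis n" and bn: "b \<in> Dis n"
    using g b by (auto simp: Dis_parts_def)
  show "sum_list (take m b) \<le> sum_list (take m g)"
  proof (cases "\<exists>i<k. i < m \<and> g ! i < b ! i")
    case False
    then show ?thesis
      using len by (intro sum_list_mono2) auto
  next
    case True
    then obtain i where i: "i < k" "i < m" "g ! i < b ! i" by blast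
    have "g ! j \<le> b ! j" if "m \<le> j" "j < k" for j
      using strictly_decreasing_nth_gap[of g i j] gap[of i j] i that len gn
      by (simp add: Dis_def)
    then have "sum_list (drop m g) \<le> sum_list (drop m b)"
      using len by (intro sum_list_mono2) auto
    then show ?thesis
      using sum_list_take_drop[OF gn, of m] sum_list_take_drop[OF bn, of m] by simp
  qed
qed

section \<open>Blocks with prescribed lengths\<close>

definition blocks_of_lengths :: "nat \<Rightarrow> nat \<Rightarrow> nat \<Rightarrow> block set" where
  "blocks_of_lengths n k l = {(\<alpha>, \<beta>) \<in> S_Block n. length \<alpha> = k \<and> length \<beta> = l}"

lemma A_same_eq_blocks_of_lengths: "A_same n k = blocks_of_lengths n k k"
  unfolding A_same_def blocks_of_lengths_def S_Block_def Dis_parts_def by auto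

lemma A_drop_eq_blocks_of_lengths: "A_drop n k = blocks_of_lengths n k (k - 1)"
  unfolding A_drop_def blocks_of_lengths_def S_Block_def Dis_parts_def by auto

lemma amphora_blocks_of_lengths:
  assumes k: "(k + 1) choose 2 \<le> n" and l: "1 \<le> l" "k = l \<or> k = l + 1"
  shows "amphora (S_Block n) (S_Block_le n) (blocks_of_lengths n k l)"
proof -
  let ?b = "bottom_partition n k" and ?t = "top_partition n l"
  let ?Q = "blocks_of_lengths n k l"
  have "(l + 1) choose 2 \<le> (k + 1) choose 2"
    using l by (intro binomial_right_mono) auto
  then have ln: "(l + 1) choose 2 \<le> n" using k by simp
  have b: "?b \<in> Dis_parts n k"
    using bottom_partition_in_Dis k l by auto
  have t: "?t \<in> Dis_parts n l"
    using top_partition_in_Dis ln l by auto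
  have x: "(?b, ?t) \<in> ?Q"
    using b t l top_partition_majorizes[OF l(1) ln, of ?b]
    by (auto simp: blocks_of_lengths_def S_Block_def Dis_parts_def)
  show ?thesis
  proof (rule convex_with_least_imp_amphora[OF partial_order_S_Block _ _ x])
    show sub: "?Q \<subseteq> S_Block n"
      by (auto simp: blocks_of_lengths_def)
    then show "finite ?Q"
      using finite_S_Block finite_subset by blast
    show "((?b, ?t), y) \<in> S_Block_le n" if y: "y \<in> ?Q" for y
    proof -
      obtain \<alpha> \<beta> where [simp]: "y = (\<alpha>, \<beta>)" by (cases y)
      have \<alpha>: "\<alpha> \<in> Dis_parts n k" and \<beta>: "\<beta> \<in> Dis n" "length \<beta> = l"
        using y by (auto simp: blocks_of_lengths_def S_Block_def Dis_parts_def)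
      have "majorizes \<alpha> ?b"
        using \<alpha> b bottom_partition_gap by (rule majorizes_of_small_gaps)
      moreover have "majorizes ?t \<beta>"
        using top_partition_majorizes[OF l(1) ln] \<beta> by simp
      ultimately show ?thesis
        using x y sub by (auto simp: S_Block_le_def)
    qed
    show "y \<in> ?Q" if "y \<in> S_Block n" "a \<in> ?Q"
      and "((?b, ?t), y) \<in> S_Block_le n" "(y, a) \<in> S_Block_le n" for y a
    proof -
      obtain \<alpha> \<beta> \<alpha>' \<beta>' where [simp]: "y = (\<alpha>, \<beta>)" "a = (\<alpha>', \<beta>')" by (cases y, cases a)
      have D: "\<alpha> \<in> Dis n" "\<beta> \<in> Dis n" "\<alpha>' \<in> Dis n" "\<beta>' \<in> Dis n" "?b \<in> Dis n" "?t \<in> Dis n"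
        using that b t by (auto simp: S_Block_def blocks_of_lengths_def Dis_parts_def)
      have "majorizes \<alpha> ?b" "majorizes ?t \<beta>" "majorizes \<alpha>' \<alpha>" "majorizes \<beta> \<beta>'"
        using that by (auto simp: S_Block_le_def)
      then have "length \<alpha> \<le> length ?b" "length ?t \<le> length \<beta>"
        "length \<alpha>' \<le> length \<alpha>" "length \<beta> \<le> length \<beta>'"
        using D majorizes_length by blast+
      moreover have "length ?b = k" "length ?t = l" "length \<alpha>' = k" "length \<beta>' = l"
        using that b t by (auto simp: blocks_of_lengths_def Dis_parts_def)
      ultimately show ?thesis
        using that by (simp add: blocks_of_lengths_def)
    qed
  qed
qed

text \<open>Both components are nonempty because \<open>n\<close> is positive, and a partition with \<open>k\<close> distinct parts
  has sum at least \<open>1 + \<dots> + k\<close>; this gives the ranges of \<open>k\<close>.\<close>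

lemma S_Block_length_cases:
  assumes n: "n > 0" and s: "(\<alpha>, \<beta>) \<in> S_Block n"
  shows "(length \<alpha> + 1) choose 2 \<le> n \<and>
    (length \<alpha> \<ge> 1 \<and> (\<alpha>, \<beta>) \<in> A_same n (length \<alpha>) \<or>
     length \<alpha> \<ge> 2 \<and> (\<alpha>, \<beta>) \<in> A_drop n (length \<alpha>))"
proof -
  have D: "\<alpha> \<in> Dis n" "\<beta> \<in> Dis n" and len: "length \<alpha> = length \<beta> \<or> length \<alpha> = length \<beta> + 1"
    using s by (auto simp: S_Block_def)
  have "\<beta> \<noteq> []" using D(2) n by (auto simp: Dis_def)
  then have "length \<beta> \<ge> 1" by (cases \<beta>) auto
  moreover have "(length \<alpha> + 1) choose 2 \<le> n"
    using D(1) choose_two_le_sum_list[of \<alpha>] by (simp add: Dis_def)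
  ultimately show ?thesis
    using s len
    by (auto simp: A_same_eq_blocks_of_lengths A_drop_eq_blocks_of_lengths blocks_of_lengths_def)
qed

theorem theorem4p14:
  fixes n :: nat
  assumes "n > 0"
  shows "let K = {k. k \<ge> 1 \<and> (k + 1) choose 2 \<le> n};
             L = {k. k \<ge> 2 \<and> (k + 1) choose 2 \<le> n}
    in S_Block n = (\<Union>k\<in>K. A_same n k) \<union> (\<Union>k\<in>L. A_drop n k)
      \<and> disjoint_family_on (A_same n) K
      \<and> disjoint_family_on (A_drop n) L
      \<and> (\<Union>k\<in>K. A_same n k) \<inter> (\<Union>k\<in>L. A_drop n k) = {}
      \<and> (\<forall>k\<in>K. amphora (S_Block n) (S_Block_le n) (A_same n k))
      \<and> (\<forall>k\<in>L. amphora (S_Block n) (S_Block_le n) (A_drop n k))"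
proof -
  define K where "K = {k. k \<ge> 1 \<and> (k + 1) choose 2 \<le> n}"
  define L where "L = {k. k \<ge> 2 \<and> (k + 1) choose 2 \<le> n}"
  note lengths = A_same_eq_blocks_of_lengths A_drop_eq_blocks_of_lengths
  have "S_Block n = (\<Union>k\<in>K. A_same n k) \<union> (\<Union>k\<in>L. A_drop n k)"
  proof
    show "S_Block n \<subseteq> (\<Union>k\<in>K. A_same n k) \<union> (\<Union>k\<in>L. A_drop n k)"
      using S_Block_length_cases[OF assms] unfolding K_def L_def by fast
    show "(\<Union>k\<in>K. A_same n k) \<union> (\<Union>k\<in>L. A_drop n k) \<subseteq> S_Block n"
      by (auto simp: lengths blocks_of_lengths_def)
  qed
  moreover have "disjoint_family_on (A_same n) K" "disjoint_family_on (A_drop n) L"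
    by (auto simp: disjoint_family_on_def lengths blocks_of_lengths_def)
  moreover have "(\<Union>k\<in>K. A_same n k) \<inter> (\<Union>k\<in>L. A_drop n k) = {}"
    by (auto simp: L_def lengths blocks_of_lengths_def)
  moreover have "\<forall>k\<in>K. amphora (S_Block n) (S_Block_le n) (A_same n k)"
    using amphora_blocks_of_lengths by (simp add: K_def lengths)
  moreover have "\<forall>k\<in>L. amphora (S_Block n) (S_Block_le n) (A_drop n k)"
  proof
    fix k assume "k \<in> L"
    then have "(k + 1) choose 2 \<le> n" "1 \<le> k - 1" "k = k - 1 + 1" by (auto simp: L_def)
    then show "amphora (S_Block n) (S_Block_le n) (A_drop n k)"
      unfolding lengths by (intro amphora_blocks_of_lengths) auto
  qed
  ultimately show ?thesis
    unfolding Let_def K_def[symmetric] L_def[symmetric] by blast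
qed

end
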